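(* Let $\alpha\in\mathbb{R}$. Irrotational $(-\alpha)$-homogeneous solutions $(u,p,\rho)\in C^1(\mathbb{R}^2\setminus\{0\})$ of the stationary inviscid Boussinesq equations having the $x_2$-symmetry are either of the following form (i) or (ii). (i) The velocity is the harmonic vector field $$u=\frac{C}{r^\alpha}\big(\sin((\alpha-1)\phi)\,e_\phi+\cos((\alpha-1)\phi)\,e_r\big),\qquad \alpha\in\mathbb{Z},$$ for some constant $C\in\mathbb{R}\setminus\{0\}$. If $\rho\equiv0$, there exists a constant $b\in\mathbb{R}$ such that $p=b\,r^{-2\alpha}$ and $\alpha(C^2+2b)=0$. If $\rho\not\equiv0$, the integer $\alpha$ is negative. (ii) The solution is a static equilibrium $u=0$, $p=p(x_2)$, $\rho=\rho(x_2)=-p'(x_2)$. If $\rho\equiv0$, then $\alpha=0$ and the pressure $p$ is constant. If $\rho\not\equiv0$, then $\alpha<-1$.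
   Context: The stationary two-dimensional inviscid Boussinesq equations for $u=(u^1,u^2)$, $p$, $\rho$ are $$u\cdot\nabla u+\nabla p=-\rho e_2,\qquad \nabla\cdot u=0,\qquad u\cdot\nabla\rho=0,\qquad e_2=(0,1),$$ considered here in $\mathbb{R}^2\setminus\{0\}$. $(u,p,\rho)$ is $(-\alpha)$-homogeneous if $u(x)=|x|^{-\alpha}u(x/|x|)$, $p(x)=|x|^{-2\alpha}p(x/|x|)$, $\rho(x)=|x|^{-2\alpha-1}\rho(x/|x|)$ for $x\ne0$. $x_2$-symmetry: $u^1(x_1,x_2)=u^1(x_1,-x_2)$, $u^2(x_1,x_2)=-u^2(x_1,-x_2)$, $p(x_1,x_2)=p(x_1,-x_2)$, $\rho(x_1,x_2)=-\rho(x_1,-x_2)$. Irrotational means $\partial_1u^2-\partial_2u^1\equiv0$. Here $(r,\phi)$ are polar coordinates, $e_r=(\cos\phi,\sin\phi)$, $e_\phi=(-\sin\phi,\cos\phi)$.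
   Formalization: In (ii) with ρ≢0, α<-1 is corrected to α≤-1 (u=0, p=-x₂²/2, ρ=x₂ is a solution with α=-1), and the identically zero solution (u,p,ρ)=0, homogeneous for every α, is excluded, since it violates "if ρ≡0 then α=0". *)

theory Defs
  imports "HOL-Analysis.Analysis"
begin

definition C1_on :: "'a::real_normed_vector set \<Rightarrow> ('a \<Rightarrow> 'b::real_normed_vector) \<Rightarrow> bool" where
  "C1_on S f \<longleftrightarrow> (\<exists>f' :: 'a \<Rightarrow> 'a \<Rightarrow>\<^sub>L 'b.
     (\<forall>x\<in>S. (f has_derivative blinfun_apply (f' x)) (at x)) \<and> continuous_on S f')"

definition pderiv_at :: "2 \<Rightarrow> (real^2 \<Rightarrow> 'b::real_normed_vector) \<Rightarrow> real^2 \<Rightarrow> 'b" where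
  "pderiv_at i f x = frechet_derivative f (at x) (axis i 1)"

definition grad :: "(real^2 \<Rightarrow> real) \<Rightarrow> real^2 \<Rightarrow> real^2" where
  "grad f x = (\<chi> i. pderiv_at i f x)"

definition div_at :: "(real^2 \<Rightarrow> real^2) \<Rightarrow> real^2 \<Rightarrow> real" where
  "div_at u x = (\<Sum>i\<in>UNIV. pderiv_at i (\<lambda>y. u y $ i) x)"

definition curl_at :: "(real^2 \<Rightarrow> real^2) \<Rightarrow> real^2 \<Rightarrow> real" where
  "curl_at u x = pderiv_at 1 (\<lambda>y. u y $ 2) x - pderiv_at 2 (\<lambda>y. u y $ 1) x"

definition advect :: "(real^2 \<Rightarrow> real^2) \<Rightarrow> (real^2 \<Rightarrow> 'b::real_normed_vector) \<Rightarrow> real^2 \<Rightarrow> 'b" where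
  "advect u f x = (\<Sum>i\<in>UNIV. (u x $ i) *\<^sub>R pderiv_at i f x)"

text \<open>The fields are total functions on the plane; their values at the origin are arbitrary
  and every condition below is imposed on the punctured plane only.\<close>

definition stationary_boussinesq ::
  "(real^2 \<Rightarrow> real^2) \<Rightarrow> (real^2 \<Rightarrow> real) \<Rightarrow> (real^2 \<Rightarrow> real) \<Rightarrow> bool" where
  "stationary_boussinesq u p \<rho> \<longleftrightarrow> (\<forall>x. x \<noteq> 0 \<longrightarrow>
     advect u u x + grad p x = - \<rho> x *\<^sub>R axis 2 1 \<and>
     div_at u x = 0 \<and>
     advect u \<rho> x = 0)"

definition homogeneous_fields ::
  "real \<Rightarrow> (real^2 \<Rightarrow> real^2) \<Rightarrow> (real^2 \<Rightarrow> real) \<Rightarrow> (real^2 \<Rightarrow> real) \<Rightarrow> bool" where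
  "homogeneous_fields \<alpha> u p \<rho> \<longleftrightarrow> (\<forall>x. x \<noteq> 0 \<longrightarrow>
     u x = norm x powr (- \<alpha>) *\<^sub>R u (x /\<^sub>R norm x) \<and>
     p x = norm x powr (- 2 * \<alpha>) * p (x /\<^sub>R norm x) \<and>
     \<rho> x = norm x powr (- 2 * \<alpha> - 1) * \<rho> (x /\<^sub>R norm x))"

definition reflect2 :: "real^2 \<Rightarrow> real^2" where
  "reflect2 x = vector [x $ 1, - (x $ 2)]"

definition x2_symmetric ::
  "(real^2 \<Rightarrow> real^2) \<Rightarrow> (real^2 \<Rightarrow> real) \<Rightarrow> (real^2 \<Rightarrow> real) \<Rightarrow> bool" where
  "x2_symmetric u p \<rho> \<longleftrightarrow> (\<forall>x. x \<noteq> 0 \<longrightarrow>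
     u x $ 1 = u (reflect2 x) $ 1 \<and>
     u x $ 2 = - (u (reflect2 x) $ 2) \<and>
     p x = p (reflect2 x) \<and>
     \<rho> x = - \<rho> (reflect2 x))"

definition irrotational :: "(real^2 \<Rightarrow> real^2) \<Rightarrow> bool" where
  "irrotational u \<longleftrightarrow> (\<forall>x. x \<noteq> 0 \<longrightarrow> curl_at u x = 0)"

definition e_r :: "real \<Rightarrow> real^2" where
  "e_r \<phi> = vector [cos \<phi>, sin \<phi>]"

definition e_phi :: "real \<Rightarrow> real^2" where
  "e_phi \<phi> = vector [- sin \<phi>, cos \<phi>]"

definition irrotational_homogeneous_solution ::
  "real \<Rightarrow> (real^2 \<Rightarrow> real^2) \<Rightarrow> (real^2 \<Rightarrow> real) \<Rightarrow> (real^2 \<Rightarrow> real) \<Rightarrow> bool" where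
  "irrotational_homogeneous_solution \<alpha> u p \<rho> \<longleftrightarrow>
     C1_on (- {0}) u \<and> C1_on (- {0}) p \<and> C1_on (- {0}) \<rho> \<and>
     stationary_boussinesq u p \<rho> \<and> homogeneous_fields \<alpha> u p \<rho> \<and>
     x2_symmetric u p \<rho> \<and> irrotational u"

text \<open>Two boundary cases of the classification of static equilibria. The zero solution
  is homogeneous of every degree, so with vanishing density the exponent is determined only for
  solutions that are not identically zero. The linear stratification below is a smooth
  equilibrium with exponent exactly -1, so with nonvanishing density the sharp
  range is \<open>\<alpha> \<le> -1\<close>, and \<open>\<alpha> < -1\<close> fails.\<close>

lemma zero_solution:
  "irrotational_homogeneous_solution \<alpha> (\<lambda>x. 0) (\<lambda>x. 0) (\<lambda>x. 0)"
proof -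
  have "C1_on S (\<lambda>x. 0)" for S :: "(real^2) set"
    unfolding C1_on_def by (rule exI[of _ "\<lambda>x. 0"]) (auto intro!: derivative_eq_intros)
  then show ?thesis
    by (auto simp: irrotational_homogeneous_solution_def stationary_boussinesq_def
        homogeneous_fields_def x2_symmetric_def irrotational_def C1_on_def advect_def
        grad_def div_at_def curl_at_def pderiv_at_def vec_eq_iff
        intro!: exI[of _ "\<lambda>x. 0"] derivative_eq_intros)
qed

lemma linear_stratification:
  "irrotational_homogeneous_solution (- 1) (\<lambda>x. 0) (\<lambda>x. - ((x $ 2)\<^sup>2 / 2)) (\<lambda>x. x $ 2)"
proof -
  have bl: "bounded_linear (\<lambda>h::real^2. h $ 2)"
    by (rule bounded_linear_vec_nth)
  have dp: "((\<lambda>x::real^2. - ((x $ 2)\<^sup>2 / 2)) has_derivative (\<lambda>h. - (x $ 2 * h $ 2))) (at x)" for x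
    by (auto intro!: derivative_eq_intros bounded_linear_imp_has_derivative[OF bl] simp: algebra_simps)
  have c0: "C1_on (- {0}) (\<lambda>x::real^2. 0::real^2)"
    unfolding C1_on_def by (rule exI[of _ "\<lambda>x. 0"]) (auto intro!: derivative_eq_intros)
  have c1: "C1_on (- {0}) (\<lambda>x::real^2. x $ 2)"
    unfolding C1_on_def
  proof (intro exI conjI ballI)
    fix x :: "real^2"
    show "((\<lambda>x::real^2. x $ 2) has_derivative blinfun_apply (Blinfun (\<lambda>h. h $ 2))) (at x)"
      unfolding bounded_linear_Blinfun_apply[OF bl] by (rule bounded_linear_imp_has_derivative[OF bl])
  qed (rule continuous_on_const)
  have c2: "C1_on (- {0}) (\<lambda>x::real^2. - ((x $ 2)\<^sup>2 / 2))"
    unfolding C1_on_def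
  proof (intro exI conjI ballI)
    fix x :: "real^2"
    show "((\<lambda>x::real^2. - ((x $ 2)\<^sup>2 / 2)) has_derivative
        blinfun_apply ((- (x $ 2)) *\<^sub>R Blinfun (\<lambda>h. h $ 2))) (at x)"
      using dp[of x]
      by (simp add: bounded_linear_Blinfun_apply[OF bl] scaleR_blinfun.rep_eq uminus_blinfun.rep_eq)
  next
    show "continuous_on (- {0}) (\<lambda>x::real^2. (- (x $ 2)) *\<^sub>R Blinfun (\<lambda>h::real^2. h $ 2))"
      by (intro continuous_intros)
  qed
  have fp: "frechet_derivative (\<lambda>x::real^2. - ((x $ 2)\<^sup>2 / 2)) (at x) = (\<lambda>h. - (x $ 2 * h $ 2))" for x
    using frechet_derivative_at[OF dp] by simp
  have hp: "(x $ 2)\<^sup>2 = norm x powr 2 * (x $ 2 / norm x)\<^sup>2" if "x \<noteq> 0" for x :: "real^2"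
    using that by (simp add: power_divide)
  show ?thesis
    using c0 c1 c2 hp
    by (auto simp: irrotational_homogeneous_solution_def stationary_boussinesq_def
        homogeneous_fields_def x2_symmetric_def irrotational_def advect_def reflect2_def
        grad_def div_at_def curl_at_def pderiv_at_def vec_eq_iff fp axis_def forall_2
        power_divide power_mult_distrib divide_simps)
qed

end

theory Submission
  imports Defs "HOL-Real_Asymp.Real_Asymp"
begin

text \<open>On the unit circle the divergence and curl conditions together with Euler's identity for
  homogeneous functions are the linear system \<open>u\<^sub>1' = - \<alpha> u\<^sub>2\<close>, \<open>u\<^sub>2' = \<alpha> u\<^sub>1\<close>; symmetry kills one of its
  two constants of integration and periodicity forces \<open>\<alpha> \<in> \<int>\<close> when the other one, \<open>C\<close>, is nonzero.
  Since \<open>u\<close> is irrotational, the momentum equation says that the Bernoulli function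
  \<open>H = p + |u|\<^sup>2 / 2\<close> has gradient \<open>- \<rho> e\<^sub>2\<close>. Hence \<open>H\<close> and \<open>\<rho>\<close> depend on \<open>x\<^sub>2\<close> only, and
  homogeneity gives \<open>\<rho> = a x\<^sub>2 powr (- 2 \<alpha> - 1)\<close> on the upper half plane. As \<open>\<rho>\<close> is odd in \<open>x\<^sub>2\<close> and
  differentiable at \<open>(1, 0)\<close>, either \<open>a = 0\<close> or \<open>- 2 \<alpha> - 1 \<ge> 1\<close>.\<close>

section \<open>Coordinates in the plane\<close>

lemma vector_2_eq_axis: "(vector [a, b] :: real^2) = a *\<^sub>R axis 1 1 + b *\<^sub>R axis 2 1"
  by (simp add: vec_eq_iff forall_2 axis_def)

lemma vector_2_eq_0_iff [simp]: "(vector [a, b] :: real^2) = 0 \<longleftrightarrow> a = 0 \<and> b = 0"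
  by (simp add: vec_eq_iff forall_2)

lemma vector_2_eta [simp]: "(vector [x $ 1, x $ 2] :: real^2) = x"
  by (simp add: vec_eq_iff forall_2)

lemma has_derivative_vector_2 [derivative_intros]:
  assumes "(f has_derivative f') F" "(g has_derivative g') F"
  shows "((\<lambda>x. vector [f x, g x] :: real^2) has_derivative (\<lambda>h. vector [f' h, g' h])) F"
  unfolding vector_2_eq_axis by (intro derivative_intros assms)

section \<open>Functions with vertical gradient\<close>

text \<open>A vertical gradient makes \<open>H\<close> constant along horizontal lines avoiding the
  origin. The line \<open>x $ 1 = 1\<close> misses the origin and meets every horizontal line, so it
  carries the whole profile of \<open>H\<close> and \<open>g\<close>, height 0 included.\<close>

lemma stratified:
  fixes H g :: "real^2 \<Rightarrow> real"
  assumes H: "\<And>x. x \<noteq> 0 \<Longrightarrow> (H has_derivative (\<lambda>h. h $ 2 * g x)) (at x)"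
  shows "\<And>s. ((\<lambda>s. H (vector [1, s])) has_real_derivative g (vector [1, s])) (at s)"
    and "\<And>x. x \<noteq> 0 \<Longrightarrow> H x = H (vector [1, x $ 2])"
    and "\<And>x. x \<noteq> 0 \<Longrightarrow> g x = g (vector [1, x $ 2])"
proof -
  have vertical: "((\<lambda>s. H (vector [a, s])) has_real_derivative g (vector [a, s])) (at s)"
    if "a \<noteq> 0 \<or> s \<noteq> 0" for a s
  proof -
    have "((\<lambda>s. H (vector [a, s])) has_derivative (\<lambda>h. (vector [0, h] :: real^2) $ 2 * g (vector [a, s]))) (at s)"
      by (rule has_derivative_compose[OF has_derivative_vector_2[OF has_derivative_const has_derivative_ident] H])
        (use that in auto)
    then show ?thesis
      by (simp add: has_real_derivative_iff_has_vector_derivative has_vector_derivative_def)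
  qed
  show q: "((\<lambda>s. H (vector [1, s])) has_real_derivative g (vector [1, s])) (at s)" for s
    using vertical[of 1 s] by simp
  have off: "H (vector [a, s]) = H (vector [1, s])" if "s \<noteq> 0" for a s
  proof -
    have "((\<lambda>a. H (vector [a, s])) has_derivative (\<lambda>h. (vector [h, 0] :: real^2) $ 2 * g (vector [a, s]))) (at a)" for a
      by (rule has_derivative_compose[OF has_derivative_vector_2[OF has_derivative_ident has_derivative_const] H])
        (use that in auto)
    then have "((\<lambda>a. H (vector [a, s])) has_real_derivative 0) (at a)" for a
      by (simp add: has_real_derivative_iff_has_vector_derivative has_vector_derivative_def)
    then show ?thesis
      using DERIV_isconst_all by blast
  qed
  \<comment> \<open>The origin cuts the horizontal axis in two, so constancy along a line cannot
    link its halves. Instead both values are limits, as the height tends to 0, of values already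
    known to agree.\<close>
  have on: "H (vector [a, 0]) = H (vector [1, 0])" if "a \<noteq> 0" for a
  proof (rule tendsto_unique)
    show "((\<lambda>s. H (vector [a, s])) \<longlongrightarrow> H (vector [a, 0])) (at 0)"
      using DERIV_isCont[OF vertical[of a 0]] that by (simp add: isCont_def)
    have "((\<lambda>s. H (vector [1, s])) \<longlongrightarrow> H (vector [1, 0])) (at 0)"
      using DERIV_isCont[OF q[of 0]] by (simp add: isCont_def)
    moreover have "\<forall>\<^sub>F s in at 0. H (vector [1, s]) = H (vector [a, s])"
      by (auto simp: eventually_at_filter off[of _ a])
    ultimately show "((\<lambda>s. H (vector [a, s])) \<longlongrightarrow> H (vector [1, 0])) (at 0)"
      by (rule Lim_transform_eventually)
  qed simp
  have all: "H (vector [a, s]) = H (vector [1, s])" if "a \<noteq> 0 \<or> s \<noteq> 0" for a s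
    using that off[of s a] on[of a] by (cases "s = 0") auto
  show "H x = H (vector [1, x $ 2])" if "x \<noteq> 0" for x
  proof -
    have "x $ 1 \<noteq> 0 \<or> x $ 2 \<noteq> 0"
      using that by (auto simp: vec_eq_iff forall_2)
    then show ?thesis
      using all[of "x $ 1" "x $ 2"] by simp
  qed
  show "g x = g (vector [1, x $ 2])" if "x \<noteq> 0" for x
  proof (rule DERIV_unique)
    have nz: "x $ 1 \<noteq> 0 \<or> x $ 2 \<noteq> 0"
      using that by (auto simp: vec_eq_iff forall_2)
    show "((\<lambda>s. H (vector [1, s])) has_real_derivative g (vector [1, x $ 2])) (at (x $ 2))"
      by (rule q)
    \<comment> \<open>The vertical lines through \<open>x\<close> and through \<open>(1, 0)\<close>
      carry the same values of \<open>H\<close> near this height, hence the same derivative. If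
      \<open>x $ 1 = 0\<close>, the neighbourhood has to exclude height 0, where the first line hits
      the origin.\<close>
    have ev: "\<forall>\<^sub>F s in nhds (x $ 2). H (vector [x $ 1, s]) = H (vector [1, s])"
    proof (cases "x $ 1 = 0")
      case True
      then have "\<forall>\<^sub>F s in nhds (x $ 2). s \<noteq> 0"
        using nz by (intro t1_space_nhds) auto
      then show ?thesis
        by eventually_elim (use all[of "x $ 1"] in auto)
    qed (use all[of "x $ 1"] in auto)
    show "((\<lambda>s. H (vector [1, s])) has_real_derivative g x) (at (x $ 2))"
      using vertical[OF nz] DERIV_cong_ev[OF refl ev refl] by simp
  qed
qed

section \<open>Powers and degrees of homogeneity\<close>

text \<open>This compares radii 1 and 2: a nonzero constant can only be homogeneous of degree
  0.\<close>

lemma powr_factor_one: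
  fixes k c :: real
  assumes "c = 2 powr k * c"
  shows "k = 0 \<or> c = 0"
proof (cases "c = 0")
  case False
  then have "2 powr k = 1"
    using assms by simp
  then show ?thesis
    by (simp add: powr_eq_one_iff_gen)
qed simp

text \<open>The right difference quotient at 0 is \<open>s powr (k - 1) * a\<close>, whose size
  tends to infinity when \<open>k < 1\<close>.\<close>

lemma powr_differentiable_at_0:
  fixes f :: "real \<Rightarrow> real"
  assumes f: "f differentiable at 0" "f 0 = 0"
    and "a \<noteq> 0"
    and powr: "\<And>s. s > 0 \<Longrightarrow> f s = s powr k * a"
  shows "k \<ge> 1"
proof (rule ccontr)
  assume "\<not> k \<ge> 1"
  obtain D where "(f has_real_derivative D) (at 0)"
    using f(1) by (auto simp: real_differentiable_def)
  then have "((\<lambda>s. f s / s) \<longlongrightarrow> D) (at_right 0)"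
    using f(2) by (auto simp: has_field_derivative_iff intro: filterlim_mono[OF _ order_refl] at_le)
  moreover have "\<forall>\<^sub>F s in at_right 0. f s / s = s powr (k - 1) * a"
    unfolding eventually_at_filter
    by (rule always_eventually) (auto simp: powr powr_diff)
  ultimately have "((\<lambda>s. s powr (k - 1) * a) \<longlongrightarrow> D) (at_right 0)"
    by (rule Lim_transform_eventually)
  then have "((\<lambda>s. s powr (k - 1) * a / a) \<longlongrightarrow> D / a) (at_right 0)"
    using \<open>a \<noteq> 0\<close> by (intro tendsto_intros)
  then have "((\<lambda>s. s powr (k - 1)) \<longlongrightarrow> D / a) (at_right 0)"
    using \<open>a \<noteq> 0\<close> by simp
  moreover have "filterlim (\<lambda>s::real. s powr (k - 1)) at_top (at_right 0)"
    using \<open>\<not> k \<ge> 1\<close> by real_asymp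
  ultimately show False
    using not_tendsto_and_filterlim_at_infinity[OF trivial_limit_at_right_real]
      filterlim_at_top_imp_at_infinity by blast
qed

section \<open>Full and partial derivatives\<close>

lemma C1_on_imp_differentiable:
  "C1_on S f \<Longrightarrow> x \<in> S \<Longrightarrow> f differentiable (at x)"
  by (auto simp: C1_on_def differentiable_def)

lemma has_derivative_pderiv_at:
  assumes "f differentiable (at x)"
  shows "(f has_derivative (\<lambda>h. h $ 1 *\<^sub>R pderiv_at 1 f x + h $ 2 *\<^sub>R pderiv_at 2 f x)) (at x)"
proof -
  interpret D: bounded_linear "frechet_derivative f (at x)"
    using assms by (auto simp: frechet_derivative_works dest: has_derivative_bounded_linear)
  have "frechet_derivative f (at x) h = h $ 1 *\<^sub>R pderiv_at 1 f x + h $ 2 *\<^sub>R pderiv_at 2 f x" for h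
  proof -
    have "h = h $ 1 *\<^sub>R axis 1 1 + h $ 2 *\<^sub>R axis 2 1"
      by (simp add: vec_eq_iff forall_2 axis_def)
    then have "frechet_derivative f (at x) h =
        frechet_derivative f (at x) (h $ 1 *\<^sub>R axis 1 1 + h $ 2 *\<^sub>R axis 2 1)"
      by simp
    then show ?thesis
      by (simp add: D.add D.scaleR pderiv_at_def)
  qed
  then have "frechet_derivative f (at x) = (\<lambda>h. h $ 1 *\<^sub>R pderiv_at 1 f x + h $ 2 *\<^sub>R pderiv_at 2 f x)"
    by blast
  then show ?thesis
    using assms by (simp add: frechet_derivative_works)
qed

lemma pderiv_at_component:
  fixes u :: "real^2 \<Rightarrow> real^2"
  assumes "u differentiable (at x)"
  shows "pderiv_at j (\<lambda>y. u y $ i) x = pderiv_at j u x $ i"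
proof -
  have "((\<lambda>y. u y $ i) has_derivative (\<lambda>h. frechet_derivative u (at x) h $ i)) (at x)"
    using assms bounded_linear.has_derivative[OF bounded_linear_vec_nth]
    by (auto simp: frechet_derivative_works)
  then show ?thesis
    unfolding pderiv_at_def by (metis frechet_derivative_at)
qed

section \<open>Polar coordinates\<close>

lemma e_r_nth [simp]: "e_r \<phi> $ 1 = cos \<phi>" "e_r \<phi> $ 2 = sin \<phi>"
  by (simp_all add: e_r_def)

lemma e_phi_nth [simp]: "e_phi \<phi> $ 1 = - sin \<phi>" "e_phi \<phi> $ 2 = cos \<phi>"
  by (simp_all add: e_phi_def)

lemma norm_e_r [simp]: "norm (e_r \<phi>) = 1"
  by (simp add: norm_vec_def L2_set_def sum_2)

lemma e_r_nonzero [simp]: "e_r \<phi> \<noteq> 0"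
  using norm_e_r[of \<phi>] by (metis norm_zero zero_neq_one)

lemma polar_cases:
  fixes x :: "real^2"
  obtains \<phi> where "x = norm x *\<^sub>R e_r \<phi>"
proof (cases "x = 0")
  case False
  have "(x $ 1 / norm x)\<^sup>2 + (x $ 2 / norm x)\<^sup>2 = ((x $ 1)\<^sup>2 + (x $ 2)\<^sup>2) / (norm x)\<^sup>2"
    by (simp add: power_divide add_divide_distrib)
  also have "\<dots> = 1"
    using False by (simp add: norm_vec_def L2_set_def sum_2 vec_eq_iff forall_2 sum_power2_eq_zero_iff)
  finally obtain \<phi> where polar: "x $ 1 / norm x = cos \<phi>" "x $ 2 / norm x = sin \<phi>"
    by (rule sincos_total_2pi)
  have "norm x * (x $ i / norm x) = x $ i" for i
    using False by simp
  from this[of 1] this[of 2] have "x = norm x *\<^sub>R e_r \<phi>"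
    by (simp add: vec_eq_iff forall_2 polar)
  then show ?thesis by (rule that)
qed (use that in auto)

section \<open>Homogeneous harmonic fields\<close>

text \<open>Both sides are the derivative of \<open>u (t *\<^sub>R x)\<close> at
  \<open>t = 1\<close>, once by the chain rule and once from the power law.\<close>

lemma euler_identity:
  fixes u :: "real^2 \<Rightarrow> 'b::real_normed_vector"
  assumes u: "(u has_derivative D) (at x)"
    and hom: "\<And>t. t > 0 \<Longrightarrow> u (t *\<^sub>R x) = t powr k *\<^sub>R u x"
  shows "D x = k *\<^sub>R u x"
proof (rule vector_derivative_unique_at)
  have "(u has_derivative D) (at (1 *\<^sub>R x))"
    using u by simp
  moreover have "((\<lambda>t. t *\<^sub>R x) has_derivative (\<lambda>h. h *\<^sub>R x)) (at (1::real))"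
    by (auto intro!: derivative_eq_intros)
  ultimately have "((\<lambda>t. u (t *\<^sub>R x)) has_derivative (\<lambda>h. D (h *\<^sub>R x))) (at (1::real))"
    using has_derivative_compose by blast
  then show "((\<lambda>t. u (t *\<^sub>R x)) has_vector_derivative D x) (at 1)"
    using has_derivative_bounded_linear[OF u]
    by (simp add: has_vector_derivative_def linear_simps)
  have "((\<lambda>t. t powr k *\<^sub>R u x) has_vector_derivative k *\<^sub>R u x) (at 1)"
    by (auto intro!: derivative_eq_intros simp: has_real_derivative_iff_has_vector_derivative[symmetric])
  moreover have "\<forall>\<^sub>F t in nhds 1. u (t *\<^sub>R x) = t powr k *\<^sub>R u x"
    using eventually_nhds_in_open[of "{0<..}" "1::real"] by (auto elim!: eventually_mono simp: hom)
  ultimately show "((\<lambda>t. u (t *\<^sub>R x)) has_vector_derivative k *\<^sub>R u x) (at 1)"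
    by (subst has_vector_derivative_cong_ev[where g = "\<lambda>t. t powr k *\<^sub>R u x"])
      (auto simp: hom elim: eventually_mono)
qed

text \<open>Euler's identity gives the radial derivative, and the divergence and curl conditions
  turn it into the tangential one. Along the circle the field then rotates at constant rate
  \<alpha>, and \<open>axis0\<close> fixes its initial direction.\<close>

lemma harmonic_homogeneous:
  fixes u :: "real^2 \<Rightarrow> real^2"
  assumes diff: "\<And>x. x \<noteq> 0 \<Longrightarrow> u differentiable (at x)"
    and div: "\<And>x. x \<noteq> 0 \<Longrightarrow> div_at u x = 0"
    and curl: "\<And>x. x \<noteq> 0 \<Longrightarrow> curl_at u x = 0"
    and hom: "\<And>x. x \<noteq> 0 \<Longrightarrow> u x = norm x powr (- \<alpha>) *\<^sub>R u (x /\<^sub>R norm x)"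
    and axis0: "u (vector [1, 0]) $ 2 = 0"
  defines "C \<equiv> u (vector [1, 0]) $ 1"
  shows "u (e_r \<phi>) = vector [C * cos (\<alpha> * \<phi>), C * sin (\<alpha> * \<phi>)]"
proof -
  have ray: "u (t *\<^sub>R e_r \<phi>) = t powr (- \<alpha>) *\<^sub>R u (e_r \<phi>)" if "t > 0" for t \<phi>
    using hom[of "t *\<^sub>R e_r \<phi>"] that by simp
  define G where "G = (\<lambda>\<phi>. u (e_r \<phi>))"
  have G': "(G has_derivative (\<lambda>h. h *\<^sub>R vector [- \<alpha> * G \<phi> $ 2, \<alpha> * G \<phi> $ 1])) (at \<phi>)" for \<phi>
  proof -
    let ?x = "e_r \<phi>"
    define A where "A = pderiv_at 1 u ?x $ 1"
    define B where "B = pderiv_at 1 u ?x $ 2"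
    have CR: "pderiv_at 2 u ?x $ 1 = B" "pderiv_at 2 u ?x $ 2 = - A"
      using div[of ?x] curl[of ?x] diff[of ?x]
      by (simp_all add: div_at_def curl_at_def pderiv_at_component sum_2 A_def B_def)
    define D where "D = (\<lambda>h::real^2. vector [h $ 1 * A + h $ 2 * B, h $ 1 * B - h $ 2 * A] :: real^2)"
    have "(\<lambda>h::real^2. h $ 1 *\<^sub>R pderiv_at 1 u ?x + h $ 2 *\<^sub>R pderiv_at 2 u ?x) = D"
      by (auto simp: fun_eq_iff D_def vec_eq_iff forall_2 CR A_def B_def)
    then have D: "(u has_derivative D) (at ?x)"
      using has_derivative_pderiv_at[of u ?x] diff[of ?x] by simp
    have "D ?x = - \<alpha> *\<^sub>R u ?x"
      by (rule euler_identity[OF D ray])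
    then have eq: "cos \<phi> * A + sin \<phi> * B = - \<alpha> * G \<phi> $ 1" "cos \<phi> * B - sin \<phi> * A = - \<alpha> * G \<phi> $ 2"
      by (simp_all add: D_def G_def vec_eq_iff forall_2)
    have "(e_r has_derivative (\<lambda>h. h *\<^sub>R e_phi \<phi>)) (at \<phi>)"
      unfolding e_r_def
      by (rule has_derivative_eq_rhs, rule derivative_intros, (rule derivative_eq_intros refl)+)
        (auto simp: fun_eq_iff vec_eq_iff forall_2)
    from has_derivative_compose[OF this D]
    have "(G has_derivative (\<lambda>h. D (h *\<^sub>R e_phi \<phi>))) (at \<phi>)"
      by (simp add: G_def)
    moreover have "D (h *\<^sub>R e_phi \<phi>) = h *\<^sub>R vector [- \<alpha> * G \<phi> $ 2, \<alpha> * G \<phi> $ 1]" for h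
    proof -
      \<comment> \<open>The matrix of \<open>D\<close> is symmetric and trace free, so its value at
        \<open>e_phi \<phi>\<close> is its value at \<open>e_r \<phi>\<close> turned clockwise by a
        right angle.\<close>
      have "D (h *\<^sub>R e_phi \<phi>) = h *\<^sub>R vector [cos \<phi> * B - sin \<phi> * A, - (cos \<phi> * A + sin \<phi> * B)]"
        by (simp add: D_def vec_eq_iff forall_2 algebra_simps)
      then show ?thesis
        unfolding eq by simp
    qed
    ultimately show ?thesis
      by simp
  qed
  have G1: "((\<lambda>\<phi>. G \<phi> $ 1) has_real_derivative - \<alpha> * G \<phi> $ 2) (at \<phi>)"
    and G2: "((\<lambda>\<phi>. G \<phi> $ 2) has_real_derivative \<alpha> * G \<phi> $ 1) (at \<phi>)" for \<phi>
    using bounded_linear.has_derivative[OF bounded_linear_vec_nth G'[of \<phi>], of 1]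
      bounded_linear.has_derivative[OF bounded_linear_vec_nth G'[of \<phi>], of 2]
    by (simp_all add: has_real_derivative_iff_has_vector_derivative has_vector_derivative_def)
  \<comment> \<open>\<open>E1\<close> and \<open>E2\<close> are the components of \<open>G\<close>
    in the frame turned by \<open>\<alpha> * \<phi>\<close>, where the rotating solution stands
    still.\<close>
  define E1 where "E1 = (\<lambda>\<phi>. cos (\<alpha> * \<phi>) * G \<phi> $ 1 + sin (\<alpha> * \<phi>) * G \<phi> $ 2)"
  define E2 where "E2 = (\<lambda>\<phi>. cos (\<alpha> * \<phi>) * G \<phi> $ 2 - sin (\<alpha> * \<phi>) * G \<phi> $ 1)"
  have "(E1 has_real_derivative 0) (at \<phi>)" "(E2 has_real_derivative 0) (at \<phi>)" for \<phi>
    unfolding E1_def E2_def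
    by (auto intro!: derivative_eq_intros G1 G2 simp: algebra_simps)
  then have "E1 \<phi> = E1 0" "E2 \<phi> = E2 0"
    using DERIV_isconst_all by blast+
  moreover have "E1 0 = C" "E2 0 = 0"
    using axis0 by (simp_all add: E1_def E2_def G_def C_def e_r_def)
  ultimately have E: "E1 \<phi> = C" "E2 \<phi> = 0"
    by simp_all
  \<comment> \<open>Turning the frame back recovers \<open>G\<close>.\<close>
  have "cos (\<alpha> * \<phi>) * E1 \<phi> - sin (\<alpha> * \<phi>) * E2 \<phi> =
      ((sin (\<alpha> * \<phi>))\<^sup>2 + (cos (\<alpha> * \<phi>))\<^sup>2) * G \<phi> $ 1"
    and "sin (\<alpha> * \<phi>) * E1 \<phi> + cos (\<alpha> * \<phi>) * E2 \<phi> =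
      ((sin (\<alpha> * \<phi>))\<^sup>2 + (cos (\<alpha> * \<phi>))\<^sup>2) * G \<phi> $ 2"
    by (simp_all only: E1_def E2_def power2_eq_square ring_distribs mult_ac)
  then show ?thesis
    by (simp add: E vec_eq_iff forall_2 G_def mult.commute)
qed

section \<open>The Bernoulli function\<close>

text \<open>Without curl the derivative matrix of \<open>u\<close> is symmetric, so the advection
  term is the gradient of half the squared speed. The momentum equation leaves only
  buoyancy.\<close>

lemma bernoulli_has_derivative:
  fixes u :: "real^2 \<Rightarrow> real^2" and p :: "real^2 \<Rightarrow> real"
  assumes u: "u differentiable (at x)" and p: "p differentiable (at x)"
    and momentum: "advect u u x + grad p x = - r *\<^sub>R axis 2 1"
    and curl: "curl_at u x = 0"
  shows "((\<lambda>y. p y + (u y \<bullet> u y) / 2) has_derivative (\<lambda>h. h $ 2 * (- r))) (at x)"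
proof -
  let ?P = "\<lambda>j. pderiv_at j u x"
  have c: "?P 1 $ 2 = ?P 2 $ 1"
    using curl u by (simp add: curl_at_def pderiv_at_component)
  have m1: "u x $ 1 * ?P 1 $ 1 + u x $ 2 * ?P 2 $ 1 + pderiv_at 1 p x = 0"
    and m2: "u x $ 1 * ?P 1 $ 2 + u x $ 2 * ?P 2 $ 2 + pderiv_at 2 p x = - r"
    using momentum
    by (simp_all add: advect_def grad_def vec_eq_iff forall_2 sum_2 axis_def)
  have "((\<lambda>y. p y + (u y \<bullet> u y) / 2) has_derivative
      (\<lambda>h. (h $ 1 *\<^sub>R pderiv_at 1 p x + h $ 2 *\<^sub>R pderiv_at 2 p x)
         + u x \<bullet> (h $ 1 *\<^sub>R ?P 1 + h $ 2 *\<^sub>R ?P 2))) (at x)"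
    using has_derivative_pderiv_at[OF u] has_derivative_pderiv_at[OF p]
    by (auto intro!: derivative_eq_intros simp: inner_commute)
  moreover have "(h $ 1 *\<^sub>R pderiv_at 1 p x + h $ 2 *\<^sub>R pderiv_at 2 p x)
         + u x \<bullet> (h $ 1 *\<^sub>R ?P 1 + h $ 2 *\<^sub>R ?P 2) = h $ 2 * (- r)" for h :: "real^2"
  proof -
    \<comment> \<open>By \<open>c\<close> the off-diagonal derivatives may be exchanged, which turns
      the coefficients of \<open>h\<close> into the two momentum components.\<close>
    have "(h $ 1 *\<^sub>R pderiv_at 1 p x + h $ 2 *\<^sub>R pderiv_at 2 p x)
         + u x \<bullet> (h $ 1 *\<^sub>R ?P 1 + h $ 2 *\<^sub>R ?P 2)
       = h $ 1 * (u x $ 1 * ?P 1 $ 1 + u x $ 2 * ?P 2 $ 1 + pderiv_at 1 p x)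
        + h $ 2 * (u x $ 1 * ?P 1 $ 2 + u x $ 2 * ?P 2 $ 2 + pderiv_at 2 p x)"
      by (simp add: inner_vec_def sum_2 c algebra_simps)
    then show ?thesis
      by (simp only: m1 m2)
  qed
  ultimately show ?thesis
    by simp
qed

section \<open>Classification of the solutions\<close>

theorem theorem1p9:
  fixes \<alpha> :: real
    and u :: "real^2 \<Rightarrow> real^2"
    and p \<rho> :: "real^2 \<Rightarrow> real"
  assumes solution: "irrotational_homogeneous_solution \<alpha> u p \<rho>"
    and nontrivial: "\<exists>x. x \<noteq> 0 \<and> (u x \<noteq> 0 \<or> p x \<noteq> 0 \<or> \<rho> x \<noteq> 0)"
  shows
    "(\<alpha> \<in> \<int> \<and>
      (\<exists>C. C \<noteq> 0 \<and>
        (\<forall>r \<phi>. r > 0 \<longrightarrow>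
          u (r *\<^sub>R e_r \<phi>) =
            (C / r powr \<alpha>) *\<^sub>R (sin ((\<alpha> - 1) * \<phi>) *\<^sub>R e_phi \<phi> + cos ((\<alpha> - 1) * \<phi>) *\<^sub>R e_r \<phi>)) \<and>
        ((\<forall>x. x \<noteq> 0 \<longrightarrow> \<rho> x = 0) \<longrightarrow>
          (\<exists>b. (\<forall>x. x \<noteq> 0 \<longrightarrow> p x = b * norm x powr (- 2 * \<alpha>)) \<and> \<alpha> * (C\<^sup>2 + 2 * b) = 0)) \<and>
        ((\<exists>x. x \<noteq> 0 \<and> \<rho> x \<noteq> 0) \<longrightarrow> \<alpha> < 0)))
     \<or>
     ((\<forall>x. x \<noteq> 0 \<longrightarrow> u x = 0) \<and>
      (\<exists>q. (\<forall>s. q differentiable (at s)) \<and>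
        (\<forall>x. x \<noteq> 0 \<longrightarrow> p x = q (x $ 2) \<and> \<rho> x = - deriv q (x $ 2))) \<and>
      ((\<forall>x. x \<noteq> 0 \<longrightarrow> \<rho> x = 0) \<longrightarrow> \<alpha> = 0 \<and> (\<exists>c. \<forall>x. x \<noteq> 0 \<longrightarrow> p x = c)) \<and>
      ((\<exists>x. x \<noteq> 0 \<and> \<rho> x \<noteq> 0) \<longrightarrow> \<alpha> \<le> -1))"
proof -
  have diff_u: "u differentiable (at x)" and diff_p: "p differentiable (at x)"
    and diff_rho: "\<rho> differentiable (at x)" if "x \<noteq> 0" for x
    using solution that
    by (auto simp: irrotational_homogeneous_solution_def intro: C1_on_imp_differentiable)
  have momentum: "advect u u x + grad p x = - \<rho> x *\<^sub>R axis 2 1"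
    and div: "div_at u x = 0" and curl: "curl_at u x = 0" if "x \<noteq> 0" for x
    using solution that
    by (auto simp: irrotational_homogeneous_solution_def stationary_boussinesq_def irrotational_def)
  have hom_u: "u x = norm x powr (- \<alpha>) *\<^sub>R u (x /\<^sub>R norm x)"
    and hom_p: "p x = norm x powr (- 2 * \<alpha>) * p (x /\<^sub>R norm x)"
    and hom_rho: "\<rho> x = norm x powr (- 2 * \<alpha> - 1) * \<rho> (x /\<^sub>R norm x)" if "x \<noteq> 0" for x
    using solution that
    unfolding irrotational_homogeneous_solution_def homogeneous_fields_def by blast+
  have sym_u: "u x $ 2 = - (u (reflect2 x) $ 2)"
    and sym_rho: "\<rho> x = - \<rho> (reflect2 x)" if "x \<noteq> 0" for x
    using solution that
    unfolding irrotational_homogeneous_solution_def x2_symmetric_def by blast+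
  have reflect_axis: "reflect2 (vector [a, 0]) = vector [a, 0]" for a
    by (simp add: reflect2_def)

  \<comment> \<open>Velocity\<close>
  define C where "C = u (vector [1, 0]) $ 1"
  have u_circle: "u (e_r \<phi>) = vector [C * cos (\<alpha> * \<phi>), C * sin (\<alpha> * \<phi>)]" for \<phi>
    unfolding C_def
  proof (rule harmonic_homogeneous[OF diff_u div curl hom_u])
    \<comment> \<open>The reflection fixes this point and reverses the second component.\<close>
    show "u (vector [1, 0]) $ 2 = 0"
      using sym_u[of "vector [1, 0]"] by (simp add: reflect_axis)
  qed
  have u_polar: "u (r *\<^sub>R e_r \<phi>) = (C / r powr \<alpha>) *\<^sub>R vector [cos (\<alpha> * \<phi>), sin (\<alpha> * \<phi>)]"
    if "r > 0" for r \<phi>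
  proof -
    have "u (r *\<^sub>R e_r \<phi>) = r powr (- \<alpha>) *\<^sub>R u (e_r \<phi>)"
      using hom_u[of "r *\<^sub>R e_r \<phi>"] that by simp
    then show ?thesis
      by (simp add: u_circle vec_eq_iff forall_2 powr_minus_divide)
  qed
  have u_sq: "u x \<bullet> u x = C\<^sup>2 * norm x powr (- 2 * \<alpha>)" if "x \<noteq> 0" for x
  proof -
    obtain \<phi> where x: "x = norm x *\<^sub>R e_r \<phi>"
      by (rule polar_cases)
    have u: "u x = (C / norm x powr \<alpha>) *\<^sub>R vector [cos (\<alpha> * \<phi>), sin (\<alpha> * \<phi>)]"
      using u_polar[of "norm x" \<phi>] that by (simp flip: x)
    have unit: "(vector [cos t, sin t] :: real^2) \<bullet> vector [cos t, sin t] = 1" for t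
      by (simp add: inner_vec_def sum_2)
    have "(norm x powr \<alpha>)\<^sup>2 = norm x powr (2 * \<alpha>)"
      by (simp add: power2_eq_square flip: powr_add)
    then show ?thesis
      unfolding u by (simp add: unit power_divide powr_minus_divide flip: power2_eq_square)
  qed

  \<comment> \<open>Stratification of the Bernoulli function and the density\<close>
  define H where "H = (\<lambda>x. p x + (u x \<bullet> u x) / 2)"
  have H: "(H has_derivative (\<lambda>h. h $ 2 * (- \<rho> x))) (at x)" if "x \<noteq> 0" for x
    unfolding H_def
    using bernoulli_has_derivative[OF diff_u diff_p momentum curl] that by blast
  have H_vertical: "((\<lambda>s. H (vector [1, s])) has_real_derivative - \<rho> (vector [1, s])) (at s)" for s
    by (rule stratified(1)[OF H])
  have H_strat: "H x = H (vector [1, x $ 2])" if "x \<noteq> 0" for x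
    by (rule stratified(2)[OF H that])
  have rho_strat: "\<rho> x = \<rho> (vector [1, x $ 2])" if "x \<noteq> 0" for x
    using stratified(3)[OF H that] by simp

  have rho_nonzero: "\<alpha> \<le> -1" if "\<exists>x. x \<noteq> 0 \<and> \<rho> x \<noteq> 0"
  proof -
    define f where "f = (\<lambda>s. \<rho> (vector [1, s]))"
    have rho_f: "\<rho> x = f (x $ 2)" if "x \<noteq> 0" for x
      using rho_strat[OF that] by (simp add: f_def)
    have f_odd: "f (- s) = - f s" for s
      using sym_rho[of "vector [1, s]"] by (simp add: f_def reflect2_def)
    \<comment> \<open>Scaling moves points off the line \<open>x $ 1 = 1\<close>. Homogeneity is
      therefore applied on the ray through \<open>(0, 1)\<close>, and stratification carries the
      values back.\<close>
    have f_powr: "f s = s powr (- 2 * \<alpha> - 1) * f 1" if "s > 0" for s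
    proof -
      have n: "norm (vector [0, s] :: real^2) = s"
        using that by (simp add: norm_vec_def L2_set_def sum_2)
      have "(vector [0, s] :: real^2) /\<^sub>R s = vector [0, 1]"
        using that by (simp add: vec_eq_iff forall_2)
      then have "\<rho> (vector [0, s]) = s powr (- 2 * \<alpha> - 1) * \<rho> (vector [0, 1])"
        using hom_rho[of "vector [0, s]"] that by (simp add: n)
      then show ?thesis
        using rho_f[of "vector [0, s]"] rho_f[of "vector [0, 1]"] that by simp
    qed
    have rho_diff: "\<rho> differentiable (at (vector [1, 0]))"
      by (rule diff_rho) simp
    have "(\<lambda>s. vector [1, s] :: real^2) differentiable (at 0)"
      unfolding differentiable_def
      by (rule exI, rule has_derivative_vector_2[OF has_derivative_const has_derivative_ident])
    from differentiable_chain_at[OF this rho_diff] have "f differentiable at 0"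
      by (simp add: f_def comp_def)
    moreover have f0: "f 0 = 0"
      using f_odd[of 0] by simp
    \<comment> \<open>Otherwise the power law and oddness would annihilate the density
      everywhere.\<close>
    moreover have "f 1 \<noteq> 0"
    proof
      assume "f 1 = 0"
      then have pos: "f s = 0" if "s > 0" for s
        using f_powr[OF that] by simp
      have "f s = 0" for s
        using pos[of s] pos[of "- s"] f_odd[of s] f0 by (cases s "0::real" rule: linorder_cases) auto
      then show False
        using that rho_f by auto
    qed
    ultimately have "- 2 * \<alpha> - 1 \<ge> 1"
      by (rule powr_differentiable_at_0) (rule f_powr)
    then show ?thesis
      by simp
  qed
  have H_const: "\<exists>c. \<forall>x. x \<noteq> 0 \<longrightarrow> H x = c" if "\<forall>x. x \<noteq> 0 \<longrightarrow> \<rho> x = 0"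
  proof -
    have "((\<lambda>s. H (vector [1, s])) has_real_derivative 0) (at s)" for s
      using H_vertical[of s] that by simp
    then have "H (vector [1, s]) = H (vector [1, 0])" for s
      using DERIV_isconst_all[of "\<lambda>s. H (vector [1, s])" s 0] by blast
    then show ?thesis
      using H_strat by metis
  qed
  \<comment> \<open>A test point off the unit circle, with the radius used in
    \<open>powr_factor_one\<close>.\<close>
  have norm2: "norm (2 *\<^sub>R e_r 0) = 2" "2 *\<^sub>R e_r 0 \<noteq> 0"
    by simp_all

  show ?thesis
  proof (cases "C = 0")

    \<comment> \<open>Harmonic flow\<close>
    case False
    \<comment> \<open>One circuit returns to the same point, so a rotation by
      \<open>\<alpha> * (2 * pi)\<close> must restore the field.\<close>
    have "e_r (2 * pi) = e_r 0"
      by (simp add: e_r_def)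
    then have "u (e_r (2 * pi)) $ 1 = u (e_r 0) $ 1"
      by simp
    then have "C * cos (\<alpha> * (2 * pi)) = C"
      unfolding u_circle by simp
    then have "cos (\<alpha> * (2 * pi)) = 1"
      using False by simp
    then obtain n :: int where "\<alpha> * (2 * pi) = of_int n * 2 * pi"
      using cos_one_2pi_int by auto
    then have "\<alpha> = of_int n"
      by simp
    then have "\<alpha> \<in> \<int>"
      by simp
    moreover have "u (r *\<^sub>R e_r \<phi>) =
        (C / r powr \<alpha>) *\<^sub>R (sin ((\<alpha> - 1) * \<phi>) *\<^sub>R e_phi \<phi> + cos ((\<alpha> - 1) * \<phi>) *\<^sub>R e_r \<phi>)"
      if "r > 0" for r \<phi>
    proof -
      \<comment> \<open>Relative to the moving frame at angle \<open>\<phi>\<close>, the field has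
        direction angle \<open>(\<alpha> - 1) * \<phi>\<close>.\<close>
      have \<phi>: "\<alpha> * \<phi> = (\<alpha> - 1) * \<phi> + \<phi>"
        by (simp add: algebra_simps)
      have "vector [cos (\<alpha> * \<phi>), sin (\<alpha> * \<phi>)] =
          sin ((\<alpha> - 1) * \<phi>) *\<^sub>R e_phi \<phi> + cos ((\<alpha> - 1) * \<phi>) *\<^sub>R e_r \<phi>"
        unfolding \<phi> cos_add sin_add by (simp add: vec_eq_iff forall_2)
      then show ?thesis
        using u_polar[OF that] by simp
    qed
    moreover have "\<exists>b. (\<forall>x. x \<noteq> 0 \<longrightarrow> p x = b * norm x powr (- 2 * \<alpha>)) \<and> \<alpha> * (C\<^sup>2 + 2 * b) = 0"
      if rho0: "\<forall>x. x \<noteq> 0 \<longrightarrow> \<rho> x = 0"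
    proof -
      obtain c where c: "\<And>x. x \<noteq> 0 \<Longrightarrow> H x = c"
        using H_const[OF rho0] by blast
      \<comment> \<open>Two formulas for the pressure: \<open>p\<close> from the constant Bernoulli
        function, \<open>pb\<close> from homogeneity. At radius 2 they force
        \<open>\<alpha> = 0\<close> or \<open>c = 0\<close>.\<close>
      have p: "p x = c - C\<^sup>2 / 2 * norm x powr (- 2 * \<alpha>)" if "x \<noteq> 0" for x
        using c[OF that] u_sq[OF that] by (simp add: H_def)
      have pb: "p x = (c - C\<^sup>2 / 2) * norm x powr (- 2 * \<alpha>)" if "x \<noteq> 0" for x
        using hom_p[OF that] p[of "x /\<^sub>R norm x"] that by simp
      have "c = 2 powr (- 2 * \<alpha>) * c"
        using p[OF norm2(2)] pb[OF norm2(2)] unfolding norm2 by (simp add: algebra_simps)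
      then have "- 2 * \<alpha> = 0 \<or> c = 0"
        by (rule powr_factor_one)
      then show ?thesis
        \<comment> \<open>For this \<open>b\<close>, \<open>C\<^sup>2 + 2 * b\<close> equals
          \<open>2 * c\<close>.\<close>
        using pb by (intro exI[of _ "c - C\<^sup>2 / 2"]) auto
    qed
    moreover have "\<alpha> < 0" if "\<exists>x. x \<noteq> 0 \<and> \<rho> x \<noteq> 0"
      using rho_nonzero[OF that] by simp
    ultimately show ?thesis
      using False by (intro disjI1 conjI exI[of _ C]) blast+
  next

    \<comment> \<open>Static equilibrium\<close>
    case True
    have u0: "u x = 0" if "x \<noteq> 0" for x
      using u_sq[OF that] True by simp
    have Hp: "H x = p x" if "x \<noteq> 0" for x
      using u0[OF that] by (simp add: H_def)
    \<comment> \<open>At rest the Bernoulli function is the pressure. On this line its profile is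
      differentiable across height 0 as well.\<close>
    define q where "q = (\<lambda>s. H (vector [1, s]))"
    have q: "(q has_real_derivative - \<rho> (vector [1, s])) (at s)" for s
      using H_vertical by (simp add: q_def)
    have "q differentiable (at s)" for s
      unfolding real_differentiable_def using q by (rule exI)
    moreover have "p x = q (x $ 2) \<and> \<rho> x = - deriv q (x $ 2)" if "x \<noteq> 0" for x
    proof
      show "p x = q (x $ 2)"
        unfolding q_def by (rule H_strat[OF that, unfolded Hp[OF that]])
      show "\<rho> x = - deriv q (x $ 2)"
        by (subst DERIV_imp_deriv[OF q], subst minus_minus) (rule rho_strat[OF that])
    qed
    moreover have "\<alpha> = 0 \<and> (\<exists>c. \<forall>x. x \<noteq> 0 \<longrightarrow> p x = c)" if rho0: "\<forall>x. x \<noteq> 0 \<longrightarrow> \<rho> x = 0"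
    proof -
      obtain c where c: "\<And>x. x \<noteq> 0 \<Longrightarrow> p x = c"
        using H_const[OF rho0] Hp by metis
      \<comment> \<open>With velocity and density zero, only the pressure can make the solution
        nontrivial.\<close>
      have "c \<noteq> 0"
        using nontrivial u0 rho0 c by auto
      have "c = 2 powr (- 2 * \<alpha>) * c"
        using hom_p[OF norm2(2)] c[OF norm2(2)] c[of "e_r 0"] by simp
      then have "- 2 * \<alpha> = 0"
        using powr_factor_one \<open>c \<noteq> 0\<close> by blast
      then show ?thesis
        using c by auto
    qed
    ultimately show ?thesis
      using u0 rho_nonzero by blast
  qed
qed

end
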